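(* Let $\mathcal H=\bigotimes_{m=1}^M\mathcal H_m$ be a finite-dimensional tensor product of complex Hilbert spaces and let $V=\sum_{i=1}^K V_i$, where each $V_i$ is a nonzero orthogonal projection on $\mathcal H$ acting on a subset of the tensor factors $\{\mathcal H_m\}$, $[V_i,V_j]=0$ for all $i\neq j$, and the smallest eigenvalue of each $V_i$ is $0$. Let the system Hamiltonian be $H=\sum_{i=1}^K H_i$ with $H_i=V_i-g_iI$, where $-g_i$ is the smallest eigenvalue of $H_i$. For each $i\in\{1,\dots,K\}$ let $U_i$ be a unitary operator on $\mathcal H$ that stabilizes $V_i$, i.e. there is $c_i>0$ with $$V_iU_i^\dagger V_iU_iV_i-V_i\leq -c_iV_i .$$ For each $i$, let $D_i=\{d\in\{1,\dots,K\}:[V_d,U_i]\neq 0\}$, so that the operators $V_j$ with $j\notin D_i$ commute with $U_i$. Suppose that (1) for every $i$ and every $d\in D_i$, $\;V_dU_i^\dagger V_dU_iV_d\leq V_d$; (2) there is $\lambda>0$ such that $\;\sum_{i=1}^K\Big(\prod_{d\in D_i}V_d\Big)\geq\lambda V$. Then, under the dissipation controls (coupling operators) $$L_i=U_i\prod_{d\in D_i}V_d,\qquad i=1,\dots,K,$$ $V$ is asymptotically ground-state stable.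
   Context: For self-adjoint operators, $A\le B$ means that $B-A$ is positive semidefinite; $[X,Y]=XY-YX$; $X^\dagger$ is the adjoint; $I$ is the identity. A density operator is an operator $\rho\geq 0$ on $\mathcal H$ with $\mathrm{trace}(\rho)=1$. Given a Hamiltonian $H$ and coupling operators (dissipation controls) $L_1,\dots,L_K$, the state $\rho_t$ evolves from an initial density operator $\rho_0$ by $$\dot\rho_t=-\mathrm{i}[H,\rho_t]+\sum_{j}\Big(L_j\rho_tL_j^\dagger-\tfrac12L_j^\dagger L_j\rho_t-\tfrac12\rho_tL_j^\dagger L_j\Big).$$ Equivalently, expectations of an operator $X$ evolve with generator $\mathcal G(X)=-\mathrm{i}[X,H]+\sum_j\big(L_j^\dagger XL_j-\tfrac12L_j^\dagger L_jX-\tfrac12XL_j^\dagger L_j\big)$. "$V$ is asymptotically ground-state stable" means that the system asymptotically converges to the ground space of $V$ (the eigenspace of $V\ge 0$ for eigenvalue $0$), i.e. $\lim_{t\to\infty}\mathrm{trace}(V\rho_t)=0$ for every initial density operator $\rho_0$. *)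

theory Defs
  imports "HOL-Analysis.Analysis"
begin

text \<open>
  Operators on a finite-dimensional complex Hilbert space with a fixed orthonormal basis
  indexed by the finite type \<open>'n\<close> are matrices of type \<open>complex^'n^'n\<close>. Beware that
  \<open>*\<close> and \<open>^\<close> are componentwise on this type: the operator product is \<open>**\<close> and the
  identity operator is \<open>mat 1\<close>.
\<close>

definition cscale :: "complex \<Rightarrow> complex^'n^'m \<Rightarrow> complex^'n^'m"  (infixr "*\<^sub>c" 75)
  where "c *\<^sub>c A = map_matrix ((*) c) A"

definition dagger :: "complex^'n^'m \<Rightarrow> complex^'m^'n"  ("_\<^sup>\<dagger>" [1000] 999)
  where "A\<^sup>\<dagger> = transpose (map_matrix cnj A)"

definition hermitian :: "complex^'n^'n \<Rightarrow> bool"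
  where "hermitian A \<longleftrightarrow> A\<^sup>\<dagger> = A"

definition unitary :: "complex^'n^'n \<Rightarrow> bool"
  where "unitary U \<longleftrightarrow> U\<^sup>\<dagger> ** U = mat 1 \<and> U ** U\<^sup>\<dagger> = mat 1"

definition orthogonal_projection :: "complex^'n^'n \<Rightarrow> bool"
  where "orthogonal_projection P \<longleftrightarrow> hermitian P \<and> P ** P = P"

definition commutator :: "complex^'n^'n \<Rightarrow> complex^'n^'n \<Rightarrow> complex^'n^'n"
  where "commutator X Y = X ** Y - Y ** X"

text \<open>Inner product, antilinear in the first argument.\<close>

definition braket :: "complex^'n \<Rightarrow> complex^'n \<Rightarrow> complex"
  where "braket x y = (\<Sum>i\<in>UNIV. cnj (x $ i) * y $ i)"

definition positive_semidefinite :: "complex^'n^'n \<Rightarrow> bool"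
  where "positive_semidefinite A \<longleftrightarrow> hermitian A \<and> (\<forall>x. Re (braket x (A *v x)) \<ge> 0)"

definition loewner_le :: "complex^'n^'n \<Rightarrow> complex^'n^'n \<Rightarrow> bool"  (infix "\<preceq>" 50)
  where "A \<preceq> B \<longleftrightarrow> positive_semidefinite (B - A)"

definition eigenvalue :: "complex^'n^'n \<Rightarrow> complex \<Rightarrow> bool"
  where "eigenvalue A c \<longleftrightarrow> (\<exists>x. x \<noteq> 0 \<and> A *v x = c *s x)"

text \<open>Meant for self-adjoint operators, all of whose eigenvalues are real.\<close>

definition smallest_eigenvalue :: "complex^'n^'n \<Rightarrow> real \<Rightarrow> bool"
  where "smallest_eigenvalue A r \<longleftrightarrow>
    eigenvalue A (complex_of_real r) \<and> (\<forall>s. eigenvalue A (complex_of_real s) \<longrightarrow> r \<le> s)"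

text \<open>
  Tensor product structure: the basis of the tensor product of the spaces \<open>\<complex>\<^bsup>d m\<^esup>\<close>,
  \<open>m = 1, \<dots>, M\<close>, consists of the tensors \<open>e\<^bsub>k 1\<^esub> \<otimes> \<dots> \<otimes> e\<^bsub>k M\<^esub>\<close> with \<open>k m < d m\<close>. The map \<open>\<phi>\<close>
  labels each element of the index type \<open>'n\<close> by such a multi-index \<open>k\<close>.
  In particular \<open>CARD('n)\<close> is the product of the \<open>d m\<close>, and every \<open>d m\<close> is positive.
\<close>

definition tensor_basis :: "nat \<Rightarrow> (nat \<Rightarrow> nat) \<Rightarrow> ('n::finite \<Rightarrow> nat \<Rightarrow> nat) \<Rightarrow> bool"
  where "tensor_basis M d \<phi> \<longleftrightarrow> bij_betw \<phi> UNIV (PiE {1..M} (\<lambda>m. {..<d m}))"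

text \<open>
  \<open>A\<close> acts on the tensor factors in \<open>S\<close>: it is of the form \<open>B \<otimes> I\<close>, with \<open>B\<close> an operator on
  the tensor product of the factors in \<open>S\<close> (given by its matrix entries between
  multi-indices over \<open>S\<close>) and \<open>I\<close> the identity on the remaining factors.
\<close>

definition acts_on ::
    "nat \<Rightarrow> ('n::finite \<Rightarrow> nat \<Rightarrow> nat) \<Rightarrow> nat set \<Rightarrow> complex^'n^'n \<Rightarrow> bool"
  where "acts_on M \<phi> S A \<longleftrightarrow> S \<subseteq> {1..M} \<and>
    (\<exists>B :: (nat \<Rightarrow> nat) \<Rightarrow> (nat \<Rightarrow> nat) \<Rightarrow> complex. \<forall>x y.
       A $ x $ y =
         (if \<forall>m\<in>{1..M} - S. \<phi> x m = \<phi> y m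
          then B (restrict (\<phi> x) S) (restrict (\<phi> y) S) else 0))"

text \<open>
  Product over a finite index set, taken in increasing order of the indices; it is used for
  pairwise commuting operators, for which the order is irrelevant. The empty product is \<open>I\<close>.
\<close>

definition op_prod :: "(nat \<Rightarrow> complex^'n^'n) \<Rightarrow> nat set \<Rightarrow> complex^'n^'n"
  where "op_prod A D = foldr (\<lambda>d B. A d ** B) (sorted_list_of_set D) (mat 1)"

definition stabilizes :: "complex^'n^'n \<Rightarrow> complex^'n^'n \<Rightarrow> bool"
  where "stabilizes U V \<longleftrightarrow>
    (\<exists>c>0. V ** U\<^sup>\<dagger> ** V ** U ** V - V \<preceq> (- c) *\<^sub>R V)"

definition density_operator :: "complex^'n^'n \<Rightarrow> bool"
  where "density_operator \<rho> \<longleftrightarrow> positive_semidefinite \<rho> \<and> trace \<rho> = 1"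

definition lindbladian ::
    "complex^'n^'n \<Rightarrow> nat set \<Rightarrow> (nat \<Rightarrow> complex^'n^'n) \<Rightarrow> complex^'n^'n \<Rightarrow> complex^'n^'n"
  where "lindbladian H J L \<rho> =
    (- \<i>) *\<^sub>c commutator H \<rho> +
    (\<Sum>j\<in>J. L j ** \<rho> ** (L j)\<^sup>\<dagger>
        - (1/2) *\<^sub>R ((L j)\<^sup>\<dagger> ** L j ** \<rho>) - (1/2) *\<^sub>R (\<rho> ** (L j)\<^sup>\<dagger> ** L j))"

definition evolves ::
    "complex^'n^'n \<Rightarrow> nat set \<Rightarrow> (nat \<Rightarrow> complex^'n^'n) \<Rightarrow> (real \<Rightarrow> complex^'n^'n) \<Rightarrow> bool"
  where "evolves H J L \<rho> \<longleftrightarrow>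
    (\<forall>t\<ge>0. (\<rho> has_vector_derivative lindbladian H J L (\<rho> t)) (at t within {0..}))"

text \<open>
  The evolution equation is linear with constant coefficients, so every initial state
  has exactly one trajectory.
\<close>

definition asymptotically_ground_state_stable ::
    "complex^'n^'n \<Rightarrow> complex^'n^'n \<Rightarrow> nat set \<Rightarrow> (nat \<Rightarrow> complex^'n^'n) \<Rightarrow> bool"
  where "asymptotically_ground_state_stable V H J L \<longleftrightarrow>
    (\<forall>\<rho>\<^sub>0. density_operator \<rho>\<^sub>0 \<longrightarrow>
      (\<forall>\<rho>. \<rho> 0 = \<rho>\<^sub>0 \<and> evolves H J L \<rho> \<longrightarrow>
         ((\<lambda>t. trace (V ** \<rho> t)) \<longlongrightarrow> 0) at_top))"

end

(* Let P i be the product of the V k with k in D i. Since U i is unitary, (L i)^dagger L i = P i, so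
   in the Heisenberg picture every V k with k not in D i drops out of the i-th term of the generator.
   Each remaining V k absorbs P i and contributes something <= 0, and k = i lies in D i and contributes
   at most - c_i P i. Summing, G(V) <= - c (sum of the P i) <= - c lambda V, and trace (V rho_t) decays
   exponentially as long as rho_t stays positive, which is shown by a first exit argument. *)

theory Submission
  imports Defs
begin

section \<open>Matrix algebra\<close>

text \<open>The energy inequality can only be tested against a nonnegative state, while the
  trajectory is given merely as a solution of a linear differential equation. What is carried along
  it is \<open>accretive\<close>: nonnegativity of the real quadratic form, with no demand of
  self-adjointness. At a null vector of such a form the commutator and the anticommutators
  contribute nothing, so the generator points inward. The price is that only the real part of the
  trace is controlled; the imaginary part comes from running the same estimate on the trajectory
  multiplied by the imaginary unit. The Hamiltonian drops out because it is \<open>V_tot\<close>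
  plus a multiple of the identity, and the two anticommutator halves merge because
  \<open>V_tot\<close> commutes with every \<open>P i\<close>. Nonvanishing of \<open>V i\<close> is
  what forces \<open>i\<close> into \<open>D i\<close>. The decay rate is the least stabilization
  constant, capped at 1, times the constant of the covering condition.\<close>

lemma matrix_mult_linear_right: "linear (\<lambda>X. A ** X)"
  for A :: "'a::real_algebra_1^'n^'m"
  by (rule linearI) (simp_all add: matrix_add_ldistrib matrix_scalar_ac scalar_matrix_assoc)

lemma matrix_mult_linear_left: "linear (\<lambda>X. X ** A)"
  for A :: "'a::real_algebra_1^'n^'m"
  by (rule linearI)
    (simp_all add: matrix_matrix_mult_def vec_eq_iff distrib_right sum.distrib scaleR_sum_right)

lemmas matrix_mult_diff_right = linear_diff[OF matrix_mult_linear_right]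
  and matrix_mult_diff_left = linear_diff[OF matrix_mult_linear_left]
  and matrix_mult_add_right = linear_add[OF matrix_mult_linear_right]
  and matrix_mult_add_left = linear_add[OF matrix_mult_linear_left]
  and matrix_mult_scaleR_right = linear_scale[OF matrix_mult_linear_right]
  and matrix_mult_scaleR_left = linear_scale[OF matrix_mult_linear_left]
  and matrix_mult_sum_right = linear_sum[OF matrix_mult_linear_right]
  and matrix_mult_sum_left = linear_sum[OF matrix_mult_linear_left]

text \<open>In finite dimension real bilinearity already gives boundedness, the source of continuity
  and differentiability of the quadratic forms below.\<close>

lemma bilinear_matrix_vector_mult:
  "bilinear (\<lambda>(A::'a::real_algebra_1^'n^'m) x. A *v x)"
  unfolding bilinear_def
proof (intro conjI allI)
  show "linear (\<lambda>A. A *v x)" for x :: "'a^'n"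
    by (rule linearI)
      (simp_all add: matrix_vector_mult_def vec_eq_iff distrib_right sum.distrib scaleR_sum_right)
qed (rule matrix_vector_mul_linear)

lemmas matrix_vector_mult_bounded_bilinear =
  bilinear_matrix_vector_mult[where 'a = complex, unfolded bilinear_conv_bounded_bilinear]

lemma matrix_vector_mult_scaleR_left: "(c *\<^sub>R A) *v x = c *\<^sub>R (A *v x)"
  for A :: "complex^'n^'m"
  by (rule bounded_bilinear.scaleR_left[OF matrix_vector_mult_bounded_bilinear])

lemma linear_trace: "linear (trace :: 'a::real_algebra_1^'n^'n \<Rightarrow> 'a)"
  by (rule linearI) (simp_all add: trace_def sum.distrib scaleR_sum_right)

lemma linear_dagger: "linear (dagger :: complex^'n^'m \<Rightarrow> complex^'m^'n)"
  by (rule linearI) (simp_all add: dagger_def transpose_def vec_eq_iff)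

lemma dagger_dagger [simp]: "(A\<^sup>\<dagger>)\<^sup>\<dagger> = A"
  by (simp add: dagger_def transpose_def vec_eq_iff)

lemma dagger_mult: "(A ** B)\<^sup>\<dagger> = B\<^sup>\<dagger> ** A\<^sup>\<dagger>"
  by (simp add: dagger_def transpose_def matrix_matrix_mult_def vec_eq_iff mult.commute)

lemma dagger_mat_1 [simp]: "(mat 1 :: complex^'n^'n)\<^sup>\<dagger> = mat 1"
  by (simp add: dagger_def transpose_def mat_def vec_eq_iff)

lemma linear_cscale: "linear (\<lambda>A::complex^'n^'m. c *\<^sub>c A)"
  by (rule linearI) (simp_all add: cscale_def vec_eq_iff distrib_left)

lemma cscale_mult_left: "(c *\<^sub>c A) ** B = c *\<^sub>c (A ** B)"
  by (simp add: cscale_def matrix_matrix_mult_def vec_eq_iff sum_distrib_left mult.assoc)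

lemma cscale_mult_right: "A ** (c *\<^sub>c B) = c *\<^sub>c (A ** B)"
  by (simp add: cscale_def matrix_matrix_mult_def vec_eq_iff sum_distrib_left mult.left_commute)

lemma cscale_vector_mult: "(c *\<^sub>c A) *v x = c *s (A *v x)"
  by (simp add: cscale_def matrix_vector_mult_def vec_eq_iff sum_distrib_left mult.assoc)

lemma trace_cscale: "trace (c *\<^sub>c A) = c * trace A"
  by (simp add: cscale_def trace_def sum_distrib_left)

lemma cscale_cscale: "a *\<^sub>c b *\<^sub>c A = b *\<^sub>c a *\<^sub>c A"
  by (simp add: cscale_def vec_eq_iff mult.left_commute)

section \<open>Positivity and the real inner product\<close>

text \<open>The real part of the complex inner product is the Euclidean inner product of the
  underlying real space, which lets real linear algebra replace complex conjugations.\<close>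

lemma Re_braket: "Re (braket x y) = x \<bullet> y"
  by (simp add: braket_def inner_vec_def inner_complex_def)

lemma dagger_inner: "x \<bullet> (A\<^sup>\<dagger> *v y) = (A *v x) \<bullet> y"
proof -
  have "braket x (A\<^sup>\<dagger> *v y) = braket (A *v x) y"
    unfolding braket_def matrix_vector_mult_def dagger_def transpose_def
    by (simp add: sum_distrib_left sum_distrib_right mult_ac) (rule sum.swap)
  then show ?thesis
    by (metis Re_braket)
qed

lemma dagger_inner_left: "(A\<^sup>\<dagger> *v x) \<bullet> y = x \<bullet> (A *v y)"
  using dagger_inner[of x "A\<^sup>\<dagger>" y] by simp

lemma cscalar_inner: "(c *s x) \<bullet> y = x \<bullet> (cnj c *s y)"
  for c :: complex
  by (simp add: inner_vec_def inner_complex_def algebra_simps)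

text \<open>The form sees only the Hermitian part of \<open>A\<close>. Leaving self-adjointness out
  spares proving that it is preserved in time, and admits the imaginary multiple of a Hermitian
  matrix, whose form is zero.\<close>

definition accretive :: "complex^'n^'n \<Rightarrow> bool"
  where "accretive A \<longleftrightarrow> (\<forall>x. 0 \<le> x \<bullet> (A *v x))"

lemma positive_semidefinite_iff: "positive_semidefinite A \<longleftrightarrow> hermitian A \<and> accretive A"
  by (simp add: positive_semidefinite_def accretive_def Re_braket)

lemma hermitian_inner: "hermitian A \<Longrightarrow> (A *v x) \<bullet> y = x \<bullet> (A *v y)"
  by (metis dagger_inner hermitian_def)

lemma hermitian_diff: "hermitian A \<Longrightarrow> hermitian B \<Longrightarrow> hermitian (A - B)"
  by (simp add: hermitian_def linear_diff[OF linear_dagger])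

lemma hermitian_scaleR: "hermitian A \<Longrightarrow> hermitian (c *\<^sub>R A)"
  by (simp add: hermitian_def linear_scale[OF linear_dagger])

lemma hermitian_sum: "(\<And>i. i \<in> I \<Longrightarrow> hermitian (A i)) \<Longrightarrow> hermitian (\<Sum>i\<in>I. A i)"
  by (simp add: hermitian_def linear_sum[OF linear_dagger])

lemma positive_semidefinite_add:
  "positive_semidefinite A \<Longrightarrow> positive_semidefinite B \<Longrightarrow> positive_semidefinite (A + B)"
  by (simp add: positive_semidefinite_iff accretive_def hermitian_def linear_add[OF linear_dagger]
      matrix_vector_mult_add_rdistrib inner_add_right)

lemma positive_semidefinite_scaleR:
  "positive_semidefinite A \<Longrightarrow> 0 \<le> c \<Longrightarrow> positive_semidefinite (c *\<^sub>R A)"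
  by (simp add: positive_semidefinite_iff accretive_def hermitian_scaleR
      matrix_vector_mult_scaleR_left)

lemma positive_semidefinite_0 [simp]: "positive_semidefinite 0"
  by (simp add: positive_semidefinite_iff accretive_def hermitian_def linear_0[OF linear_dagger])

lemma positive_semidefinite_sum:
  "(\<And>i. i \<in> I \<Longrightarrow> positive_semidefinite (A i)) \<Longrightarrow> positive_semidefinite (\<Sum>i\<in>I. A i)"
  by (induction I rule: infinite_finite_induct) (simp_all add: positive_semidefinite_add)

lemma positive_semidefinite_conjugate:
  "positive_semidefinite A \<Longrightarrow> positive_semidefinite (B\<^sup>\<dagger> ** A ** B)"
  by (simp add: positive_semidefinite_iff accretive_def hermitian_def dagger_mult matrix_mul_assoc
      matrix_vector_mul_assoc[symmetric] dagger_inner)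

lemma positive_semidefinite_projection:
  assumes "orthogonal_projection P" shows "positive_semidefinite P"
proof -
  have "positive_semidefinite (mat 1 :: complex^'n^'n)"
    by (simp add: positive_semidefinite_iff accretive_def hermitian_def)
  from positive_semidefinite_conjugate[OF this, of P] show ?thesis
    using assms by (simp add: orthogonal_projection_def hermitian_def)
qed

text \<open>A nonnegative form is minimal where it vanishes, so its linear part vanishes there.\<close>

lemma accretive_null_vector:
  assumes "accretive A" and null: "x \<bullet> (A *v x) = 0"
  shows "y \<bullet> (A *v x) + x \<bullet> (A *v y) = 0"
proof -
  define b c where "b = y \<bullet> (A *v x) + x \<bullet> (A *v y)" and "c = y \<bullet> (A *v y)"
  have c: "c \<ge> 0"
    using assms(1) by (simp add: accretive_def c_def)
  have *: "0 \<le> s * b + s\<^sup>2 * c" for s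
  proof -
    have "0 \<le> (x + s *\<^sub>R y) \<bullet> (A *v (x + s *\<^sub>R y))"
      using assms(1) by (simp add: accretive_def)
    also have "\<dots> = s * b + s\<^sup>2 * c"
      by (simp add: linear_add[OF matrix_vector_mul_linear] linear_scale[OF matrix_vector_mul_linear]
          inner_add_left inner_add_right null b_def c_def power2_eq_square algebra_simps)
    finally show ?thesis .
  qed
  \<comment> \<open>At \<open>s = - r\<close> the form equals \<open>- r\<^sup>2\<close>. The
    minimizer would divide by \<open>c\<close>; using \<open>c + 1\<close> avoids a separate case
    \<open>c = 0\<close>.\<close>
  define r where "r = b / (c + 1)"
  have b: "b = r * (c + 1)"
    using c by (simp add: r_def)
  have "r\<^sup>2 \<le> 0"
    using *[of "- r"] by (simp add: b algebra_simps power2_eq_square)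
  then have "b = 0"
    by (simp add: b)
  then show ?thesis
    by (simp add: b_def)
qed

lemma hermitian_entry: "hermitian A \<Longrightarrow> A $ j $ i = cnj (A $ i $ j)"
  unfolding hermitian_def dagger_def transpose_def
  by (metis (no_types, lifting) nth_map_matrix vec_lambda_beta)

lemma matrix_mult_axis: "(A *v axis k 1) $ j = A $ j $ k"
  for A :: "'a::semiring_1^'n^'m"
  by (simp add: matrix_vector_mult_def axis_def if_distrib cong: if_cong)

lemma axis_inner: "axis k 1 \<bullet> x = Re (x $ k)" for x :: "complex^'n"
  by (simp add: inner_axis' inner_complex_def)

lemma accretive_diag: "accretive A \<Longrightarrow> 0 \<le> Re (A $ k $ k)"
  by (metis accretive_def axis_inner matrix_mult_axis)

text \<open>The form is homogeneous of degree two, so unit vectors decide. Compactness of the sphere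
  later yields a uniform bound and a first exit time.\<close>

lemma accretiveI_sphere:
  fixes A :: "complex^'n^'n"
  assumes "\<And>x. x \<in> sphere 0 1 \<Longrightarrow> 0 \<le> x \<bullet> (A *v x)"
  shows "accretive A"
  unfolding accretive_def
proof
  fix x :: "complex^'n"
  have scale: "(r *\<^sub>R u) \<bullet> (A *v (r *\<^sub>R u)) = r\<^sup>2 * (u \<bullet> (A *v u))" for r u
    by (simp add: linear_scale[OF matrix_vector_mul_linear] power2_eq_square)
  have x: "norm x *\<^sub>R sgn x = x"
    by (cases "x = 0") (simp_all add: sgn_div_norm)
  have "x \<bullet> (A *v x) = (norm x)\<^sup>2 * (sgn x \<bullet> (A *v sgn x))"
    using scale[of "norm x" "sgn x"] unfolding x .
  then show "0 \<le> x \<bullet> (A *v x)"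
    using assms[of "sgn x"] by (cases "x = 0") (simp_all add: norm_sgn)
qed

text \<open>Cholesky decomposition: subtracting a rank-one matrix from \<open>A\<close> clears a diagonal entry.\<close>

lemma trace_mult_accretive_nonneg:
  fixes A R :: "complex^'n^'n"
  assumes "positive_semidefinite A" and R: "accretive R"
  shows "0 \<le> Re (trace (A ** R))"
  using assms(1)
proof (induction "card {k. A $ k $ k \<noteq> 0}" arbitrary: A rule: less_induct)
  case less
  have herm: "hermitian A" and acc: "accretive A"
    using less.prems by (simp_all add: positive_semidefinite_iff)
  have Im_diag: "Im (A $ j $ j) = 0" for j
    using hermitian_entry[OF herm, of j j] by (simp add: complex_eq_iff)
  show ?case
  proof (cases "\<forall>k. A $ k $ k = 0")
    case True
    \<comment> \<open>A zero diagonal makes every basis vector a null vector; testing the vanishing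
      linear part in the direction of its own image gives norm zero.\<close>
    have "A *v axis k 1 = 0" for k
    proof -
      let ?e = "axis k 1 :: complex^'n" let ?y = "A *v ?e"
      have "?e \<bullet> ?y = 0"
        by (simp add: axis_inner matrix_mult_axis True)
      from accretive_null_vector[OF acc this, of ?y]
      have "?y \<bullet> ?y = 0"
        using hermitian_inner[OF herm, of ?e ?y] by simp
      then show ?thesis by simp
    qed
    then have "A = 0"
      by (metis matrix_mult_axis vec_eq_iff zero_index)
    then show ?thesis
      by (simp add: trace_def)
  next
    case False
    then obtain k where k: "A $ k $ k \<noteq> 0" by blast
    define a where "a = Re (A $ k $ k)"
    have Akk: "A $ k $ k = of_real a"
      using Im_diag[of k] by (simp add: a_def complex_eq_iff)
    have "0 \<le> a"
      using accretive_diag[OF acc] by (simp add: a_def)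
    with k Akk have a: "0 < a" by (metis less_eq_real_def of_real_0)
    define v where "v = A *v axis k 1"
    have v: "v $ j = A $ j $ k" for j
      by (simp add: v_def matrix_mult_axis)
    \<comment> \<open>With \<open>v\<close> the \<open>k\<close>-th column of \<open>A\<close>, the
      matrix \<open>(1 / a) *\<^sub>R Q\<close> has the same \<open>k\<close>-th row and column as
      \<open>A\<close>; \<open>B\<close> is the Schur complement padded with zeros.\<close>
    define Q where "Q = (\<chi> i j. v $ i * cnj (v $ j))"
    define B where "B = A - (1 / a) *\<^sub>R Q"
    have Q_mult: "Q *v x = braket v x *s v" for x
      by (simp add: Q_def braket_def matrix_vector_mult_def vec_eq_iff sum_distrib_left mult_ac)
    have braket_v: "braket v x = (A *v x) $ k" for x
      by (simp add: hermitian_entry[OF herm, symmetric] braket_def v matrix_vector_mult_def)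
    have herm_B: "hermitian B"
      unfolding B_def
      by (intro hermitian_diff hermitian_scaleR herm)
        (simp add: hermitian_def Q_def dagger_def transpose_def vec_eq_iff mult.commute)
    have "0 \<le> x \<bullet> (B *v x)" for x
    proof -
      define w where "w = (A *v x) $ k"
      \<comment> \<open>This \<open>c\<close> minimizes the form of \<open>A\<close> along the line
        from \<open>x\<close> in direction \<open>e\<close>, and the minimum is exactly the form of
        \<open>B\<close> at \<open>x\<close>.\<close>
      define c where "c = (1 / a) *\<^sub>R w"
      define e where "e = (axis k 1 :: complex^'n)"
      have e_inner: "(z *s e) \<bullet> y = Re (cnj z * y $ k)" for z y
        by (simp add: e_def cscalar_inner axis_inner)
      have Ae: "A *v (c *s e) = c *s v"
        by (simp add: vector_scalar_commute e_def v_def)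
      have xv: "x \<bullet> (z *s v) = Re (cnj w * z)" for z
      proof -
        have "x \<bullet> (z *s v) = (z *s v) \<bullet> x" by (rule inner_commute)
        also have "\<dots> = (A *v (z *s e)) \<bullet> x"
          by (simp add: vector_scalar_commute e_def v_def)
        also have "\<dots> = Re (cnj z * w)"
          by (simp add: hermitian_inner[OF herm] e_inner w_def)
        also have "\<dots> = Re (cnj w * z)" by (simp add: algebra_simps)
        finally show ?thesis .
      qed
      have "0 \<le> (x - c *s e) \<bullet> (A *v (x - c *s e))"
        using acc by (simp add: accretive_def)
      also have "\<dots> = x \<bullet> (A *v x) - x \<bullet> (c *s v) - Re (cnj c * w) + Re (cnj c * (c * v $ k))"
        by (simp add: matrix_vector_mult_diff_distrib Ae inner_diff_left inner_diff_right e_inner w_def)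
      also have "\<dots> = x \<bullet> (A *v x) - Re (cnj w * w) / a"
        using a by (simp add: xv v Akk c_def field_simps)
      also have "\<dots> = x \<bullet> (B *v x)"
        by (simp add: B_def matrix_vector_mult_diff_rdistrib matrix_vector_mult_scaleR_left
            Q_mult braket_v inner_diff_right xv flip: w_def)
      finally show ?thesis .
    qed
    then have psd_B: "positive_semidefinite B"
      using herm_B by (simp add: positive_semidefinite_iff accretive_def)
    have diag_B: "B $ j $ j = A $ j $ j - of_real ((cmod (v $ j))\<^sup>2 / a)" for j
    proof -
      have "v $ j * cnj (v $ j) = of_real ((cmod (v $ j))\<^sup>2)"
        by (rule complex_norm_square[symmetric])
      then show ?thesis
        by (simp add: B_def Q_def complex_eq_iff)
    qed
    have "B $ k $ k = 0"
      using a by (simp add: diag_B v Akk power2_eq_square)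
    \<comment> \<open>A zero diagonal entry of \<open>A\<close> can only decrease, yet must stay
      nonnegative, so it stays zero. Hence the number of nonzero diagonal entries strictly
      drops.\<close>
    moreover have "B $ j $ j = 0" if "A $ j $ j = 0" for j
    proof -
      have "0 \<le> Re (B $ j $ j)"
        using psd_B by (simp add: positive_semidefinite_iff accretive_diag)
      then have "(cmod (v $ j))\<^sup>2 / a \<le> 0"
        by (simp add: diag_B that)
      then show ?thesis
        using a by (simp add: diag_B that divide_le_0_iff)
    qed
    ultimately have "{k. B $ k $ k \<noteq> 0} \<subset> {k. A $ k $ k \<noteq> 0}"
      using k by auto
    then have "0 \<le> Re (trace (B ** R))"
      by (intro less.hyps psd_B psubset_card_mono) auto
    moreover have "trace (Q ** R) = braket v (R *v v)"
    proof -
      have "trace (Q ** R) = (\<Sum>i\<in>UNIV. \<Sum>j\<in>UNIV. v $ i * cnj (v $ j) * R $ j $ i)"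
        by (simp add: trace_def matrix_matrix_mult_def Q_def)
      also have "\<dots> = (\<Sum>j\<in>UNIV. \<Sum>i\<in>UNIV. v $ i * cnj (v $ j) * R $ j $ i)"
        by (rule sum.swap)
      also have "\<dots> = braket v (R *v v)"
        by (simp add: braket_def matrix_vector_mult_def sum_distrib_left mult_ac)
      finally show ?thesis .
    qed
    then have "0 \<le> Re (trace (Q ** R))"
      using R by (simp add: Re_braket accretive_def)
    moreover have "A = B + (1 / a) *\<^sub>R Q"
      by (simp add: B_def)
    then have "trace (A ** R) = trace (B ** R) + (1 / a) *\<^sub>R trace (Q ** R)"
      by (simp only: matrix_mult_add_left matrix_mult_scaleR_left linear_add[OF linear_trace]
          linear_scale[OF linear_trace])
    ultimately show ?thesis
      using a by simp
  qed
qed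

lemma trace_mono:
  assumes "A \<preceq> B" "accretive R"
  shows "Re (trace (A ** R)) \<le> Re (trace (B ** R))"
  using trace_mult_accretive_nonneg[of "B - A" R] assms
  by (simp add: loewner_le_def matrix_mult_diff_left linear_diff[OF linear_trace])

section \<open>Positivity of the evolution\<close>

text \<open>A first exit argument: perturb \<open>\<rho>\<close> to \<open>\<rho> + \<epsilon> e\<^bsup>C t\<^esup> I\<close>. At the first time at which the form of
  the perturbed trajectory vanishes at some unit vector \<open>x\<close>, its derivative at \<open>x\<close> is both
  nonpositive and, for \<open>C\<close> large, positive.\<close>

lemma accretive_invariant:
  fixes F :: "complex^'n^'n \<Rightarrow> complex^'n^'n"
  assumes lin: "linear F"
    and inward: "\<And>A x. accretive A \<Longrightarrow> x \<bullet> (A *v x) = 0 \<Longrightarrow> 0 \<le> x \<bullet> (F A *v x)"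
    and deriv: "\<And>t. 0 \<le> t \<Longrightarrow> (\<rho> has_vector_derivative F (\<rho> t)) (at t within {0..})"
    and init: "accretive (\<rho> 0)"
    and T: "0 \<le> T"
  shows "accretive (\<rho> T)"
proof -
  let ?S = "sphere 0 1 :: (complex^'n) set"
  have unit: "x \<bullet> x = 1" if "x \<in> ?S" for x
    using that by (simp add: dot_square_norm)
  have cont_q: "continuous_on X (\<lambda>z. h z \<bullet> (A z *v h z))"
    if "continuous_on X A" "continuous_on X h"
    for X and A :: "'z::topological_space \<Rightarrow> complex^'n^'n" and h
    by (intro continuous_on_inner bounded_bilinear.continuous_on[OF matrix_vector_mult_bounded_bilinear] that)
  have "compact ((\<lambda>x. x \<bullet> (F (mat 1) *v x)) ` ?S)"
    by (intro compact_continuous_image cont_q) (auto intro: continuous_intros)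
  from compact_imp_bounded[OF this, THEN bounded_imp_bdd_above]
  obtain C0 where "\<And>x. x \<in> ?S \<Longrightarrow> x \<bullet> (F (mat 1) *v x) \<le> C0"
    unfolding bdd_above_def by blast
  \<comment> \<open>Strictness here makes the derivative at the exit time strictly positive.\<close>
  then obtain C where C: "\<And>x. x \<in> ?S \<Longrightarrow> x \<bullet> (F (mat 1) *v x) < C"
    by (meson gt_ex le_less_trans)
  have pos: "0 < x \<bullet> (\<rho> T *v x) + \<epsilon> * exp (C * T)" if \<epsilon>: "0 < \<epsilon>" and "x \<in> ?S" for \<epsilon> x
  proof (rule ccontr)
    assume neg: "\<not> ?thesis"
    define E where "E t = \<rho> t + (\<epsilon> * exp (C * t)) *\<^sub>R mat 1" for t
    have q_E: "y \<bullet> (E t *v y) = y \<bullet> (\<rho> t *v y) + \<epsilon> * exp (C * t) * (y \<bullet> y)" for t y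
      by (simp add: E_def matrix_vector_mult_add_rdistrib matrix_vector_mult_scaleR_left inner_add_right)
    have cont_\<rho>: "continuous_on {0..} \<rho>"
      by (auto simp: continuous_on_eq_continuous_within intro!: has_vector_derivative_continuous deriv)
    then have cont_E: "continuous_on {0..} E"
      unfolding E_def by (intro continuous_intros)
    \<comment> \<open>Pairs of a time and a unit vector at which positivity has failed; compactness
      makes the earliest such time attained.\<close>
    define Z where "Z = ({0..T} \<times> ?S) \<inter> (\<lambda>z. snd z \<bullet> (E (fst z) *v snd z)) -` {..0}"
    have "compact ({0..T} \<times> ?S)"
      by (intro compact_Times) auto
    have "continuous_on ({0..T} \<times> ?S) (\<lambda>z. snd z \<bullet> (E (fst z) *v snd z))"
      by (intro cont_q continuous_on_compose2[OF cont_E]) (auto intro!: continuous_intros)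
    then have "closedin (top_of_set ({0..T} \<times> ?S)) Z"
      unfolding Z_def by (intro continuous_closedin_preimage closed_atMost)
    with \<open>compact ({0..T} \<times> ?S)\<close> have "compact Z"
      by (rule closedin_compact)
    have "(T, x) \<in> Z"
      using neg T that(2) by (simp add: Z_def q_E unit)
    then have "Z \<noteq> {}" by blast
    obtain z where "z \<in> Z" and min: "\<And>z'. z' \<in> Z \<Longrightarrow> fst z \<le> fst z'"
      using continuous_attains_inf[OF \<open>compact Z\<close> \<open>Z \<noteq> {}\<close> continuous_on_fst[OF continuous_on_id]]
      by blast
    then obtain t y where ty: "t \<in> {0..T}" "y \<in> ?S" "y \<bullet> (E t *v y) \<le> 0" "z = (t, y)"
      by (cases z) (auto simp: Z_def)
    have before: "0 < w \<bullet> (E s *v w)" if "s \<in> {0..<t}" "w \<in> ?S" for s w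
      using min[of "(s, w)"] that ty by (force simp: Z_def)
    have "0 \<le> y \<bullet> (\<rho> 0 *v y)"
      using init by (simp add: accretive_def)
    then have "t \<noteq> 0"
      using ty \<epsilon> by (auto simp: q_E unit)
    then have t: "0 < t" using ty by simp
    \<comment> \<open>Positivity before \<open>t\<close> passes to the left limit for every
      direction at once, so \<open>E t\<close> is accretive with null vector \<open>y\<close>, as
      \<open>inward\<close> requires.\<close>
    have at_t: "0 \<le> w \<bullet> (E t *v w)" if w: "w \<in> ?S" for w
    proof (rule tendsto_lowerbound)
      have "continuous_on {0..t} (\<lambda>s. w \<bullet> (E s *v w))"
        by (intro cont_q continuous_on_subset[OF cont_E]) auto
      then show "((\<lambda>s. w \<bullet> (E s *v w)) \<longlongrightarrow> w \<bullet> (E t *v w)) (at_left t)"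
        using t by (auto simp: continuous_on_def at_within_Icc_at_left dest: bspec[of _ _ t])
      show "\<forall>\<^sub>F s in at_left t. 0 \<le> w \<bullet> (E s *v w)"
        using eventually_at_left_real[OF t] by eventually_elim (auto intro!: less_imp_le before w)
    qed simp
    have acc_E: "accretive (E t)"
      by (rule accretiveI_sphere) (rule at_t)
    have null: "y \<bullet> (E t *v y) = 0"
      using at_t[of y] ty by simp
    \<comment> \<open>The time derivative at \<open>t\<close> of the form of \<open>E\<close> at the
      fixed vector \<open>y\<close>. Linearity of \<open>F\<close> trades \<open>\<rho> t\<close>
      for \<open>E t\<close> at the cost of a multiple of \<open>F (mat 1)\<close>, which
      \<open>C\<close> dominates.\<close>
    define D where "D = y \<bullet> (F (\<rho> t) *v y) + \<epsilon> * (C * exp (C * t))"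
    have "F (E t) = F (\<rho> t) + (\<epsilon> * exp (C * t)) *\<^sub>R F (mat 1)"
      by (simp add: E_def linear_add[OF lin] linear_scale[OF lin])
    then have "y \<bullet> (F (\<rho> t) *v y) =
        y \<bullet> (F (E t) *v y) - \<epsilon> * exp (C * t) * (y \<bullet> (F (mat 1) *v y))"
      by (simp add: matrix_vector_mult_add_rdistrib matrix_vector_mult_scaleR_left inner_add_right)
    then have "D = y \<bullet> (F (E t) *v y) + \<epsilon> * exp (C * t) * (C - y \<bullet> (F (mat 1) *v y))"
      by (simp add: D_def algebra_simps)
    moreover have "0 \<le> y \<bullet> (F (E t) *v y)"
      by (rule inward[OF acc_E null])
    ultimately have "0 < D"
      using \<epsilon> C[OF ty(2)] by (simp add: add_nonneg_pos)
    moreover have "((\<lambda>s. y \<bullet> (E s *v y)) has_real_derivative D) (at t within {0..})"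
    proof -
      have "bounded_linear (\<lambda>A. y \<bullet> (A *v y))"
        by (intro bounded_linear_inner_right_comp
            bounded_bilinear.bounded_linear_left[OF matrix_vector_mult_bounded_bilinear])
      from bounded_linear.has_vector_derivative[OF this deriv[of t]]
      have "((\<lambda>s. y \<bullet> (\<rho> s *v y)) has_real_derivative y \<bullet> (F (\<rho> t) *v y)) (at t within {0..})"
        using t by (simp add: has_real_derivative_iff_has_vector_derivative)
      then have "((\<lambda>s. y \<bullet> (\<rho> s *v y) + \<epsilon> * exp (C * s)) has_real_derivative D) (at t within {0..})"
        unfolding D_def by (auto intro!: derivative_eq_intros)
      then show ?thesis
        by (simp add: q_E unit[OF ty(2)])
    qed
    ultimately obtain \<delta> where "\<delta> > 0"
      and dec: "\<And>h. 0 < h \<Longrightarrow> 0 \<le> t - h \<Longrightarrow> h < \<delta> \<Longrightarrow> (y \<bullet> (E (t - h) *v y)) < y \<bullet> (E t *v y)"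
      using has_real_derivative_pos_inc_left[of "\<lambda>s. y \<bullet> (E s *v y)" D t "{0..}"] by auto
    \<comment> \<open>A step back that stays in nonnegative time: there the form would be negative,
      against positivity before \<open>t\<close>.\<close>
    define h where "h = min (\<delta> / 2) t"
    have "0 < h" "0 \<le> t - h" "h < \<delta>"
      using \<open>\<delta> > 0\<close> t by (auto simp: h_def)
    with dec[of h] before[of "t - h" y] null ty show False by auto
  qed
  show ?thesis
  proof (rule accretiveI_sphere, rule field_le_epsilon)
    fix x e assume x: "x \<in> ?S" and "0 < (e::real)"
    then show "0 \<le> x \<bullet> (\<rho> T *v x) + e"
      using pos[OF _ x, of "e / exp (C * T)"] by simp
  qed
qed

lemma linear_lindbladian: "linear (lindbladian H J L)"
proof -
  have "linear (\<lambda>\<rho>. A ** \<rho> ** B)" for A B :: "complex^'n^'n"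
    using linear_compose[OF matrix_mult_linear_right matrix_mult_linear_left] by (simp add: o_def)
  moreover have "linear (\<lambda>\<rho>. \<rho> ** A ** B)" for A B :: "complex^'n^'n"
    using matrix_mult_linear_left[of "A ** B"] by (simp add: matrix_mul_assoc)
  moreover have "linear (\<lambda>\<rho>. c *\<^sub>c commutator H \<rho>)" for c
    using linear_compose[OF linear_compose_sub[OF matrix_mult_linear_right[of H]
        matrix_mult_linear_left[of H]] linear_cscale[of c]]
    by (simp add: o_def commutator_def)
  ultimately show ?thesis
    unfolding lindbladian_def[abs_def]
    by (intro linear_compose_add linear_compose_sum linear_compose_sub ballI
        linear_compose_scale_right matrix_mult_linear_right)
qed

lemma lindbladian_cscale: "lindbladian H J L (c *\<^sub>c \<rho>) = c *\<^sub>c lindbladian H J L \<rho>"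
proof -
  have scaleR: "r *\<^sub>R (c *\<^sub>c A) = c *\<^sub>c (r *\<^sub>R A)" for r and A :: "complex^'n^'n"
    by (simp add: linear_scale[OF linear_cscale])
  show ?thesis
    unfolding lindbladian_def commutator_def
    by (simp add: cscale_mult_left cscale_mult_right linear_add[OF linear_cscale]
        linear_diff[OF linear_cscale] linear_sum[OF linear_cscale] scaleR cscale_cscale)
qed

lemma evolves_cscale:
  assumes "evolves H J L \<rho>" shows "evolves H J L (\<lambda>t. c *\<^sub>c \<rho> t)"
  using assms bounded_linear.has_vector_derivative[OF linear_conv_bounded_linear[THEN iffD1, OF linear_cscale]]
  unfolding evolves_def lindbladian_cscale by blast

text \<open>The Hamiltonian and anticommutator terms have the form \<open>B\<^sup>\<dagger> A + A B\<close> and vanish at a null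
  vector, while the jump terms are nonnegative.\<close>

lemma lindbladian_inward:
  fixes H A :: "complex^'n^'n"
  assumes herm: "hermitian H" and acc: "accretive A" and null: "x \<bullet> (A *v x) = 0"
  shows "0 \<le> x \<bullet> (lindbladian H J L A *v x)"
proof -
  have zero: "y \<bullet> (A *v x) + x \<bullet> (A *v y) = 0" for y
    by (rule accretive_null_vector[OF acc null])
  \<comment> \<open>In this direction the null-vector identity is precisely the Hamiltonian term, as
    \<open>H\<close> moves across the inner product.\<close>
  let ?y = "\<i> *s (H *v x)"
  have "x \<bullet> (((- \<i>) *\<^sub>c commutator H A) *v x) = ?y \<bullet> (A *v x) + x \<bullet> (A *v ?y)"
    by (simp add: cscale_vector_mult commutator_def matrix_vector_mult_diff_rdistrib cscalar_inner
        matrix_vector_mul_assoc[symmetric] vector_scalar_commute hermitian_inner[OF herm]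
        inner_diff_right vector_space_over_itself.scale_right_diff_distrib)
  then have ham: "x \<bullet> (((- \<i>) *\<^sub>c commutator H A) *v x) = 0"
    by (simp only: zero)
  have jump: "0 \<le> x \<bullet> ((M ** A ** M\<^sup>\<dagger> - (1/2) *\<^sub>R (M\<^sup>\<dagger> ** M ** A) - (1/2) *\<^sub>R (A ** M\<^sup>\<dagger> ** M)) *v x)"
    for M
  proof -
    let ?z = "M\<^sup>\<dagger> *v (M *v x)" and ?u = "M\<^sup>\<dagger> *v x"
    have "x \<bullet> ((M ** A ** M\<^sup>\<dagger> - (1/2) *\<^sub>R (M\<^sup>\<dagger> ** M ** A) - (1/2) *\<^sub>R (A ** M\<^sup>\<dagger> ** M)) *v x) =
        ?u \<bullet> (A *v ?u) - (1/2) * (?z \<bullet> (A *v x) + x \<bullet> (A *v ?z))"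
      by (simp add: matrix_vector_mult_diff_rdistrib matrix_vector_mult_scaleR_left inner_diff_right
          matrix_vector_mul_assoc[symmetric] dagger_inner dagger_inner_left
          algebra_simps)
    also have "\<dots> = ?u \<bullet> (A *v ?u)"
      by (simp only: zero)
    also have "\<dots> \<ge> 0"
      using acc by (simp add: accretive_def)
    finally show ?thesis .
  qed
  have sum_mult: "(\<Sum>j\<in>J. B j) *v x = (\<Sum>j\<in>J. B j *v x)" for B :: "nat \<Rightarrow> complex^'n^'n"
    by (rule bounded_bilinear.sum_left[OF matrix_vector_mult_bounded_bilinear])
  show ?thesis
    unfolding lindbladian_def
    by (simp add: matrix_vector_mult_add_rdistrib inner_add_right ham sum_mult inner_sum_right)
      (intro sum_nonneg jump)
qed

lemma evolves_accretive:
  assumes "evolves H J L \<rho>" "hermitian H" "accretive (\<rho> 0)" "0 \<le> t"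
  shows "accretive (\<rho> t)"
proof (rule accretive_invariant[where F = "lindbladian H J L" and \<rho> = \<rho>])
  show "0 \<le> x \<bullet> (lindbladian H J L A *v x)" if "accretive A" "x \<bullet> (A *v x) = 0" for A x
    using assms(2) that by (rule lindbladian_inward)
qed (use assms in \<open>simp_all add: evolves_def linear_lindbladian\<close>)

section \<open>Exponential decay of the energy\<close>

lemma commutator_eq_0_iff: "commutator A B = 0 \<longleftrightarrow> A ** B = B ** A"
  by (simp add: commutator_def)

section \<open>Ordered products of commuting projections\<close>

lemma op_prod_induct:
  assumes "finite D" and "P (mat 1)"
    and "\<And>k B. k \<in> D \<Longrightarrow> P B \<Longrightarrow> P (A k ** B)"
  shows "P (op_prod A D)"
proof -
  have "P (foldr (\<lambda>d B. A d ** B) ks (mat 1))" if "set ks \<subseteq> D" for ks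
    using that by (induction ks) (simp_all add: assms)
  then show ?thesis
    by (simp add: op_prod_def assms(1))
qed

lemma op_prod_commute:
  assumes "finite D" and "\<And>k. k \<in> D \<Longrightarrow> X ** A k = A k ** X"
  shows "X ** op_prod A D = op_prod A D ** X"
proof (rule op_prod_induct[OF assms(1)])
  fix k B assume "k \<in> D" "X ** B = B ** X"
  then show "X ** (A k ** B) = A k ** B ** X"
    by (metis assms(2) matrix_mul_assoc)
qed simp

text \<open>\<open>A k\<close> is moved past the other factors until it meets its own copy, where
  idempotence merges the two. The induction runs on the list itself because the position of
  \<open>k\<close> matters.\<close>

lemma op_prod_absorb:
  assumes "finite D" "k \<in> D" and idem: "A k ** A k = A k"
    and comm: "\<And>l. l \<in> D \<Longrightarrow> A k ** A l = A l ** A k"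
  shows "A k ** op_prod A D = op_prod A D"
proof -
  have "A k ** foldr (\<lambda>d B. A d ** B) ks (mat 1) = foldr (\<lambda>d B. A d ** B) ks (mat 1)"
    if "set ks \<subseteq> D" "k \<in> set ks" for ks
    using that
  proof (induction ks)
    case (Cons l ks)
    show ?case
    proof (cases "l = k")
      case True
      then show ?thesis by (simp add: matrix_mul_assoc idem)
    next
      case False
      with Cons have "A k ** foldr (\<lambda>d B. A d ** B) ks (mat 1) = foldr (\<lambda>d B. A d ** B) ks (mat 1)"
        by simp
      moreover have "A k ** A l = A l ** A k"
        using Cons.prems by (intro comm) simp
      ultimately show ?thesis
        by (simp add: matrix_mul_assoc) (simp flip: matrix_mul_assoc)
    qed
  qed simp
  from this[of "sorted_list_of_set D"] show ?thesis
    using assms(1,2) by (simp add: op_prod_def)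
qed

lemma op_prod_projection:
  assumes "finite D" and proj: "\<And>k. k \<in> D \<Longrightarrow> orthogonal_projection (A k)"
    and comm: "\<And>k l. k \<in> D \<Longrightarrow> l \<in> D \<Longrightarrow> A k ** A l = A l ** A k"
  shows "orthogonal_projection (op_prod A D)"
proof -
  \<comment> \<open>Taking adjoints reverses the factors; commutation with each factor is carried
    along to restore the order.\<close>
  have "(op_prod A D)\<^sup>\<dagger> = op_prod A D \<and> (\<forall>k\<in>D. A k ** op_prod A D = op_prod A D ** A k)"
  proof (rule op_prod_induct[OF assms(1)])
    fix k B assume k: "k \<in> D" and B: "B\<^sup>\<dagger> = B \<and> (\<forall>l\<in>D. A l ** B = B ** A l)"
    have "(A k)\<^sup>\<dagger> = A k"
      using proj[OF k] by (simp add: orthogonal_projection_def hermitian_def)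
    moreover have "A l ** (A k ** B) = A k ** B ** A l" if "l \<in> D" for l
      using B comm[OF k that] that by (metis matrix_mul_assoc)
    ultimately show "(A k ** B)\<^sup>\<dagger> = A k ** B \<and> (\<forall>l\<in>D. A l ** (A k ** B) = A k ** B ** A l)"
      using B k by (simp add: dagger_mult)
  qed simp
  \<comment> \<open>Only the left copy is unfolded: each of its factors is absorbed by the intact
    right copy.\<close>
  moreover have "op_prod A D ** op_prod A D = op_prod A D"
  proof (rule op_prod_induct[OF assms(1), of "\<lambda>B. B ** op_prod A D = op_prod A D"])
    fix k B assume k: "k \<in> D" and B: "B ** op_prod A D = op_prod A D"
    have "A k ** op_prod A D = op_prod A D"
      using proj[OF k] by (intro op_prod_absorb[OF assms(1) k] comm k)
        (simp_all add: orthogonal_projection_def)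
    then show "A k ** B ** op_prod A D = op_prod A D"
      by (simp add: B flip: matrix_mul_assoc)
  qed simp
  ultimately show ?thesis
    by (simp add: orthogonal_projection_def hermitian_def)
qed

text \<open>By cyclicity of the trace the generator acts on \<open>X\<close> instead of \<open>\<rho>\<close> (Heisenberg picture).\<close>

lemma trace_mult_lindbladian:
  fixes X H :: "complex^'n^'n"
  assumes XH: "X ** H = H ** X" and XL: "\<And>j. j \<in> J \<Longrightarrow> X ** ((L j)\<^sup>\<dagger> ** L j) = (L j)\<^sup>\<dagger> ** L j ** X"
  shows "trace (X ** lindbladian H J L \<rho>) =
    trace ((\<Sum>j\<in>J. (L j)\<^sup>\<dagger> ** X ** L j - X ** ((L j)\<^sup>\<dagger> ** L j)) ** \<rho>)"
proof -
  note lin = linear_diff[OF linear_trace] linear_scale[OF linear_trace] linear_sum[OF linear_trace]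
    linear_add[OF linear_trace]
  have "trace (X ** (H ** \<rho>)) = trace (X ** (\<rho> ** H))"
    by (metis XH matrix_mul_assoc trace_mul_sym)
  then have ham: "trace (X ** ((- \<i>) *\<^sub>c commutator H \<rho>)) = 0"
    by (simp add: cscale_mult_right trace_cscale commutator_def matrix_mult_diff_right lin)
  \<comment> \<open>Cyclicity together with \<open>XL\<close> makes both anticommutator halves
    equal, so they add up to one full term.\<close>
  have jump: "trace (X ** (L j ** \<rho> ** (L j)\<^sup>\<dagger> - (1/2) *\<^sub>R ((L j)\<^sup>\<dagger> ** L j ** \<rho>)
        - (1/2) *\<^sub>R (\<rho> ** (L j)\<^sup>\<dagger> ** L j))) =
      trace (((L j)\<^sup>\<dagger> ** X ** L j - X ** ((L j)\<^sup>\<dagger> ** L j)) ** \<rho>)" if "j \<in> J" for j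
  proof -
    define M N where "M = L j" and "N = (L j)\<^sup>\<dagger>"
    have "trace (X ** (M ** \<rho> ** N)) = trace ((X ** M ** \<rho>) ** N)"
      by (simp add: matrix_mul_assoc)
    also have "\<dots> = trace (N ** (X ** M ** \<rho>))"
      by (rule trace_mul_sym)
    finally have 1: "trace (X ** (M ** \<rho> ** N)) = trace (N ** X ** M ** \<rho>)"
      by (simp add: matrix_mul_assoc)
    have "trace (X ** (\<rho> ** N ** M)) = trace ((X ** \<rho>) ** (N ** M))"
      by (simp add: matrix_mul_assoc)
    also have "\<dots> = trace ((N ** M) ** (X ** \<rho>))"
      by (rule trace_mul_sym)
    also have "\<dots> = trace ((N ** M ** X) ** \<rho>)"
      by (simp add: matrix_mul_assoc)
    also have "N ** M ** X = X ** (N ** M)"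
      using XL[OF that] by (simp add: M_def N_def)
    finally have 2: "trace (X ** (\<rho> ** N ** M)) = trace (X ** (N ** M) ** \<rho>)" .
    have 3: "trace (X ** (N ** M ** \<rho>)) = trace (X ** (N ** M) ** \<rho>)"
      by (simp add: matrix_mul_assoc)
    have "trace (X ** (M ** \<rho> ** N - (1/2) *\<^sub>R (N ** M ** \<rho>) - (1/2) *\<^sub>R (\<rho> ** N ** M))) =
        trace (N ** X ** M ** \<rho>) - (1/2) *\<^sub>R trace (X ** (N ** M) ** \<rho>)
          - (1/2) *\<^sub>R trace (X ** (N ** M) ** \<rho>)"
      by (simp only: matrix_mult_diff_right matrix_mult_scaleR_right lin 1 2 3)
    also have "\<dots> = trace ((N ** X ** M - X ** (N ** M)) ** \<rho>)"
      by (simp add: matrix_mult_diff_left lin complex_eq_iff)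
    finally show ?thesis
      by (simp only: M_def N_def)
  qed
  have "trace (X ** lindbladian H J L \<rho>) = (\<Sum>j\<in>J. trace (X ** (L j ** \<rho> ** (L j)\<^sup>\<dagger>
      - (1/2) *\<^sub>R ((L j)\<^sup>\<dagger> ** L j ** \<rho>) - (1/2) *\<^sub>R (\<rho> ** (L j)\<^sup>\<dagger> ** L j))))"
    by (simp only: lindbladian_def matrix_mult_add_right lin ham matrix_mult_sum_right add_0)
  also have "\<dots> = (\<Sum>j\<in>J. trace (((L j)\<^sup>\<dagger> ** X ** L j - X ** ((L j)\<^sup>\<dagger> ** L j)) ** \<rho>))"
    by (rule sum.cong[OF refl jump])
  finally show ?thesis
    by (simp only: matrix_mult_sum_left lin)
qed

text \<open>Gronwall: \<open>exp (\<kappa> * t) * f t\<close> has nonpositive derivative. The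
  derivative at 0 is one-sided, so monotonicity uses interior derivatives and continuity up to the
  endpoint.\<close>

lemma exponential_decay:
  fixes f :: "real \<Rightarrow> real"
  assumes \<kappa>: "0 < \<kappa>" and nonneg: "\<And>t. 0 \<le> t \<Longrightarrow> 0 \<le> f t"
    and deriv: "\<And>t. 0 \<le> t \<Longrightarrow> (f has_real_derivative f' t) (at t within {0..})"
    and bound: "\<And>t. 0 \<le> t \<Longrightarrow> f' t \<le> - \<kappa> * f t"
  shows "(f \<longlongrightarrow> 0) at_top"
proof -
  have decay: "f t \<le> f 0 * exp (- \<kappa> * t)" if t: "0 \<le> t" for t
  proof -
    define h where "h s = exp (\<kappa> * s) * f s" for s
    have h_deriv: "(h has_real_derivative exp (\<kappa> * s) * (f' s + \<kappa> * f s)) (at s within {0..})"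
      if "0 \<le> s" for s
      unfolding h_def using deriv[OF that]
      by (auto intro!: derivative_eq_intros simp: algebra_simps)
    have "h t \<le> h 0"
    proof (rule DERIV_nonpos_imp_decreasing_open[OF t])
      fix s assume s: "0 < s" "s < t"
      have "at s within {0..} = at s"
        using s by (intro at_within_interior) simp
      then have "(h has_real_derivative exp (\<kappa> * s) * (f' s + \<kappa> * f s)) (at s)"
        using h_deriv[of s] s by simp
      moreover have "exp (\<kappa> * s) * (f' s + \<kappa> * f s) \<le> 0"
        using bound[of s] s by (simp add: mult_nonneg_nonpos)
      ultimately show "\<exists>y. (h has_real_derivative y) (at s) \<and> y \<le> 0" by blast
    next
      have "continuous_on {0..} h"
        by (rule DERIV_continuous_on) (use h_deriv in simp)
      then show "continuous_on {0..t} h"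
        by (rule continuous_on_subset) auto
    qed
    then show ?thesis
      by (simp add: h_def exp_minus field_simps)
  qed
  have "((\<lambda>t. exp (- \<kappa> * t)) \<longlongrightarrow> 0) at_top"
    by (rule filterlim_compose[OF exp_at_bot])
      (rule filterlim_tendsto_neg_mult_at_bot[OF tendsto_const _ filterlim_ident], simp add: \<kappa>)
  from tendsto_mult_right_zero[OF this, of "f 0"]
  have lim: "((\<lambda>t. f 0 * exp (- \<kappa> * t)) \<longlongrightarrow> 0) at_top" .
  show ?thesis
  proof (rule tendsto_sandwich[OF _ _ tendsto_const lim])
    show "\<forall>\<^sub>F t in at_top. 0 \<le> f t" "\<forall>\<^sub>F t in at_top. f t \<le> f 0 * exp (- \<kappa> * t)"
      using nonneg decay by (auto intro: eventually_mono[OF eventually_ge_at_top[of 0]])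
  qed
qed

text \<open>Since multiples of \<open>\<rho>\<close> evolve by the same equation, the real part of the claim for \<open>\<i> \<rho>\<close>
  yields the imaginary part for \<open>\<rho>\<close>; the form of \<open>\<i> \<rho>\<close> is initially zero, hence accretive.\<close>

lemma ground_state_stable_of_dissipation:
  fixes X H :: "complex^'n^'n"
  assumes \<kappa>: "0 < \<kappa>" and psd: "positive_semidefinite X" and H: "hermitian H"
    and XH: "X ** H = H ** X" and XL: "\<And>j. j \<in> J \<Longrightarrow> X ** ((L j)\<^sup>\<dagger> ** L j) = (L j)\<^sup>\<dagger> ** L j ** X"
    and diss: "(\<Sum>j\<in>J. (L j)\<^sup>\<dagger> ** X ** L j - X ** ((L j)\<^sup>\<dagger> ** L j)) \<preceq> (- \<kappa>) *\<^sub>R X"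
  shows "asymptotically_ground_state_stable X H J L"
  unfolding asymptotically_ground_state_stable_def
proof (intro allI impI)
  have Re_lim: "((\<lambda>t. Re (trace (X ** \<sigma> t))) \<longlongrightarrow> 0) at_top"
    if ev: "evolves H J L \<sigma>" and init: "accretive (\<sigma> 0)" for \<sigma>
  proof (rule exponential_decay[OF \<kappa>])
    fix t :: real assume t: "0 \<le> t"
    have acc: "accretive (\<sigma> t)"
      by (rule evolves_accretive[OF ev H init t])
    show "0 \<le> Re (trace (X ** \<sigma> t))"
      by (rule trace_mult_accretive_nonneg[OF psd acc])
    have "linear (\<lambda>A. Re (trace (X ** A)))"
      using linear_compose[OF linear_compose[OF matrix_mult_linear_right linear_trace]
          bounded_linear.linear[OF bounded_linear_Re]] by (simp add: o_def)
    then have "bounded_linear (\<lambda>A. Re (trace (X ** A)))"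
      by (simp add: linear_conv_bounded_linear)
    from bounded_linear.has_vector_derivative[OF this, of \<sigma> "lindbladian H J L (\<sigma> t)"]
    show "((\<lambda>t. Re (trace (X ** \<sigma> t))) has_real_derivative
        Re (trace (X ** lindbladian H J L (\<sigma> t)))) (at t within {0..})"
      using ev t by (simp add: evolves_def has_real_derivative_iff_has_vector_derivative)
    have "Re (trace (((- \<kappa>) *\<^sub>R X) ** \<sigma> t)) = - \<kappa> * Re (trace (X ** \<sigma> t))"
      unfolding matrix_mult_scaleR_left linear_scale[OF linear_trace] by simp
    then show "Re (trace (X ** lindbladian H J L (\<sigma> t))) \<le> - \<kappa> * Re (trace (X ** \<sigma> t))"
      using trace_mono[OF diss acc] by (simp only: trace_mult_lindbladian[OF XH XL])
  qed
  fix \<rho>\<^sub>0 \<rho> assume "density_operator \<rho>\<^sub>0" and "\<rho> 0 = \<rho>\<^sub>0 \<and> evolves H J L \<rho>"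
  then have herm: "hermitian (\<rho> 0)" and acc: "accretive (\<rho> 0)" and ev: "evolves H J L \<rho>"
    by (auto simp: density_operator_def positive_semidefinite_iff)
  \<comment> \<open>A Hermitian matrix has real expectations, so multiplication by the imaginary
    unit leaves no real part; the chain shows the value to be its own negative.\<close>
  have "x \<bullet> ((\<i> *\<^sub>c \<rho> 0) *v x) = 0" for x
  proof -
    have "x \<bullet> ((\<i> *\<^sub>c \<rho> 0) *v x) = (cnj \<i> *s x) \<bullet> (\<rho> 0 *v x)"
      by (simp only: cscale_vector_mult cscalar_inner complex_cnj_cnj)
    also have "\<dots> = (cnj \<i> *s (\<rho> 0 *v x)) \<bullet> x"
      by (simp only: hermitian_inner[OF herm, symmetric] vector_scalar_commute)
    also have "\<dots> = - (x \<bullet> ((\<i> *\<^sub>c \<rho> 0) *v x))"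
      unfolding cscale_vector_mult inner_vec_def inner_complex_def sum_negf[symmetric]
      by (rule sum.cong) simp_all
    finally show ?thesis by simp
  qed
  then have "accretive (\<i> *\<^sub>c \<rho> 0)"
    by (simp add: accretive_def)
  from Re_lim[OF evolves_cscale[OF ev] this] have "((\<lambda>t. - Im (trace (X ** \<rho> t))) \<longlongrightarrow> 0) at_top"
    by (simp add: cscale_mult_right trace_cscale)
  from tendsto_minus[OF this] have "((\<lambda>t. Im (trace (X ** \<rho> t))) \<longlongrightarrow> 0) at_top"
    by simp
  with Re_lim[OF ev acc] show "((\<lambda>t. trace (X ** \<rho> t)) \<longlongrightarrow> 0) at_top"
    by (simp add: tendsto_complex_iff)
qed

section \<open>Compressing operator inequalities to the range of a projection\<close>

lemma conjugate_absorb: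
  fixes P :: "complex^'n^'n"
  assumes P: "P ** P = P" and XP: "X ** P = P" and PX: "P ** X = P"
  shows "P ** (X ** Y ** X ** Z ** X - X) ** P = P ** Y ** X ** Z ** P - P"
proof -
  have "B ** X ** P = B ** P" for B :: "complex^'n^'n"
    by (simp add: XP flip: matrix_mul_assoc)
  then show ?thesis
    by (simp add: matrix_mult_diff_right matrix_mult_diff_left matrix_mul_assoc PX P)
qed

text \<open>Conjugation by \<open>P\<close> preserves the order, and \<open>X\<close> acts as the
  identity on the range of \<open>P\<close>: the outer copies of \<open>X\<close> vanish and only
  the one between \<open>U\<^sup>\<dagger>\<close> and \<open>U\<close> survives. Lowering
  \<open>c\<close> to \<open>c0\<close> costs a nonnegative multiple of \<open>P\<close>.\<close>

lemma loewner_le_jump: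
  fixes P X U :: "complex^'n^'n"
  assumes P: "orthogonal_projection P" and le: "X ** U\<^sup>\<dagger> ** X ** U ** X - X \<preceq> (- c) *\<^sub>R X"
    and XP: "X ** P = P" and PX: "P ** X = P" and "c0 \<le> c"
  shows "P ** U\<^sup>\<dagger> ** X ** U ** P - P \<preceq> (- c0) *\<^sub>R P"
proof -
  have PP: "P ** P = P" and Pd: "P\<^sup>\<dagger> = P"
    using P by (simp_all add: orthogonal_projection_def hermitian_def)
  have "positive_semidefinite (P\<^sup>\<dagger> ** ((- c) *\<^sub>R X - (X ** U\<^sup>\<dagger> ** X ** U ** X - X)) ** P)"
    using le unfolding loewner_le_def by (rule positive_semidefinite_conjugate)
  also have "P\<^sup>\<dagger> ** ((- c) *\<^sub>R X - (X ** U\<^sup>\<dagger> ** X ** U ** X - X)) ** P =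
      (- c) *\<^sub>R (P ** X ** P) - P ** (X ** U\<^sup>\<dagger> ** X ** U ** X - X) ** P"
    by (simp only: Pd matrix_mult_diff_right matrix_mult_diff_left matrix_mult_scaleR_right
        matrix_mult_scaleR_left)
  also have "\<dots> = (- c) *\<^sub>R P - (P ** U\<^sup>\<dagger> ** X ** U ** P - P)"
    by (simp only: conjugate_absorb[OF PP XP PX] PX PP)
  finally have "positive_semidefinite ((- c) *\<^sub>R P - (P ** U\<^sup>\<dagger> ** X ** U ** P - P))" .
  moreover have "positive_semidefinite ((c - c0) *\<^sub>R P)"
    using assms(5) by (intro positive_semidefinite_scaleR positive_semidefinite_projection P) simp
  ultimately have "positive_semidefinite ((- c) *\<^sub>R P - (P ** U\<^sup>\<dagger> ** X ** U ** P - P) + (c - c0) *\<^sub>R P)"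
    by (rule positive_semidefinite_add)
  then show ?thesis
    by (simp add: loewner_le_def algebra_simps)
qed

theorem theorem5:
  fixes M K :: nat
    and d :: "nat \<Rightarrow> nat"
    and \<phi> :: "'n::finite \<Rightarrow> nat \<Rightarrow> nat"
    and S D :: "nat \<Rightarrow> nat set"
    and V U H L :: "nat \<Rightarrow> complex^'n^'n"
    and g :: "nat \<Rightarrow> real"
    and V_tot H_tot :: "complex^'n^'n"
  assumes tensor: "tensor_basis M d \<phi>"
    and V_tot: "V_tot = (\<Sum>i=1..K. V i)"
    and V_nonzero: "\<And>i. i \<in> {1..K} \<Longrightarrow> V i \<noteq> 0"
    and V_projection: "\<And>i. i \<in> {1..K} \<Longrightarrow> orthogonal_projection (V i)"
    and V_local: "\<And>i. i \<in> {1..K} \<Longrightarrow> acts_on M \<phi> (S i) (V i)"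
    and V_commute: "\<And>i j. i \<in> {1..K} \<Longrightarrow> j \<in> {1..K} \<Longrightarrow> i \<noteq> j \<Longrightarrow> commutator (V i) (V j) = 0"
    and V_smallest: "\<And>i. i \<in> {1..K} \<Longrightarrow> smallest_eigenvalue (V i) 0"
    and H_tot: "H_tot = (\<Sum>i=1..K. H i)"
    and H: "\<And>i. i \<in> {1..K} \<Longrightarrow> H i = V i - g i *\<^sub>R mat 1"
    and H_smallest: "\<And>i. i \<in> {1..K} \<Longrightarrow> smallest_eigenvalue (H i) (- g i)"
    and U_unitary: "\<And>i. i \<in> {1..K} \<Longrightarrow> unitary (U i)"
    and U_stabilizes: "\<And>i. i \<in> {1..K} \<Longrightarrow> stabilizes (U i) (V i)"
    and D: "\<And>i. i \<in> {1..K} \<Longrightarrow> D i = {k \<in> {1..K}. commutator (V k) (U i) \<noteq> 0}"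
    and cond1: "\<And>i k. i \<in> {1..K} \<Longrightarrow> k \<in> D i \<Longrightarrow>
      V k ** (U i)\<^sup>\<dagger> ** V k ** U i ** V k \<preceq> V k"
    and cond2: "\<exists>\<mu>>0. \<mu> *\<^sub>R V_tot \<preceq> (\<Sum>i=1..K. op_prod V (D i))"
    and L: "\<And>i. i \<in> {1..K} \<Longrightarrow> L i = U i ** op_prod V (D i)"
  shows "asymptotically_ground_state_stable V_tot H_tot {1..K} L"
proof -
  define P where "P i = op_prod V (D i)" for i
  have V_herm: "hermitian (V k)" and V_idem: "V k ** V k = V k" if "k \<in> {1..K}" for k
    using V_projection[OF that] by (simp_all add: orthogonal_projection_def)
  have V_comm: "V k ** V l = V l ** V k" if "k \<in> {1..K}" "l \<in> {1..K}" for k l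
    using V_commute[OF that] by (cases "k = l") (simp_all add: commutator_eq_0_iff)
  have D_sub: "D i \<subseteq> {1..K}" and D_fin: "finite (D i)" if "i \<in> {1..K}" for i
    using D[OF that] by auto
  have P_proj: "orthogonal_projection (P i)" if "i \<in> {1..K}" for i
    unfolding P_def using D_sub[OF that]
    by (intro op_prod_projection D_fin[OF that] V_projection V_comm) auto
  have PP: "P i ** P i = P i" and Pd: "(P i)\<^sup>\<dagger> = P i" if "i \<in> {1..K}" for i
    using P_proj[OF that] by (simp_all add: orthogonal_projection_def hermitian_def)
  have VP: "V k ** P i = P i ** V k" if "i \<in> {1..K}" "k \<in> {1..K}" for i k
    unfolding P_def using D_sub[OF that(1)] that(2)
    by (intro op_prod_commute D_fin[OF that(1)] V_comm) auto
  have absorb: "V k ** P i = P i" if i: "i \<in> {1..K}" and k: "k \<in> D i" for i k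
    unfolding P_def using D_sub[OF i] k
    by (intro op_prod_absorb D_fin[OF i] k V_idem V_comm) auto
  have UU: "(U i)\<^sup>\<dagger> ** U i = mat 1" if "i \<in> {1..K}" for i
    using U_unitary[OF that] by (simp add: unitary_def)
  have L_eq: "L i = U i ** P i" if "i \<in> {1..K}" for i
    using L[OF that] by (simp add: P_def)
  have UUX: "B ** (U i)\<^sup>\<dagger> ** U i = B" if "i \<in> {1..K}" for i B
    by (simp add: UU[OF that] flip: matrix_mul_assoc)
  have LL: "(L i)\<^sup>\<dagger> ** L i = P i" if "i \<in> {1..K}" for i
    using that by (simp add: L_eq dagger_mult Pd PP UUX matrix_mul_assoc)
  obtain c where c_pos: "\<And>i. i \<in> {1..K} \<Longrightarrow> 0 < c i"
    and c: "\<And>i. i \<in> {1..K} \<Longrightarrow> V i ** (U i)\<^sup>\<dagger> ** V i ** U i ** V i - V i \<preceq> (- c i) *\<^sub>R V i"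
    using U_stabilizes unfolding stabilizes_def by metis
  \<comment> \<open>A rate common to all \<open>i\<close>; the inserted 1 keeps the minimum defined
    and positive when \<open>K = 0\<close>.\<close>
  define c0 where "c0 = Min (insert 1 (c ` {1..K}))"
  have c0_pos: "0 < c0"
    using c_pos by (auto simp: c0_def)
  have c0_le: "c0 \<le> c i" if "i \<in> {1..K}" for i
    unfolding c0_def using that by (intro Min_le) auto
  \<comment> \<open>If \<open>U i\<close> commuted with \<open>V i\<close>, conjugation would change
    nothing and stabilization would read \<open>0 \<preceq> (- c i) *\<^sub>R V i\<close>, forcing
    \<open>V i = 0\<close>.\<close>
  have self_D: "i \<in> D i" if i: "i \<in> {1..K}" for i
  proof (rule ccontr)
    assume "i \<notin> D i"
    then have comm: "V i ** U i = U i ** V i"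
      using D[OF i] i by (simp add: commutator_eq_0_iff)
    have "V i ** (U i)\<^sup>\<dagger> ** V i ** U i ** V i = V i ** (U i)\<^sup>\<dagger> ** (V i ** U i) ** V i"
      by (simp add: matrix_mul_assoc)
    also have "\<dots> = V i"
      by (simp add: comm matrix_mul_assoc UUX[OF i] V_idem[OF i])
    finally have "positive_semidefinite ((- c i) *\<^sub>R V i)"
      using c[OF i] by (simp add: loewner_le_def)
    then have "x \<bullet> (V i *v x) \<le> 0" for x
      using c_pos[OF i] by (simp add: positive_semidefinite_iff accretive_def
          matrix_vector_mult_scaleR_left[of "- c i", simplified] mult_le_0_iff)
    moreover have "x \<bullet> (V i *v x) = (V i *v x) \<bullet> (V i *v x)" for x
      using hermitian_inner[OF V_herm[OF i], of x "V i *v x"]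
      by (simp add: matrix_vector_mul_assoc V_idem[OF i])
    ultimately have "V i *v x = 0" for x
      by (metis inner_eq_zero_iff inner_ge_zero order_antisym)
    then have "V i = 0"
      by (simp add: matrix_eq)
    with V_nonzero[OF i] show False by simp
  qed
  \<comment> \<open>The contribution of \<open>V k\<close> to the \<open>i\<close>-th dissipator;
    for \<open>k\<close> in \<open>D i\<close> the last term is just \<open>P i\<close>, the shape
    of \<open>loewner_le_jump\<close>.\<close>
  define W where "W i k = P i ** (U i)\<^sup>\<dagger> ** V k ** U i ** P i - V k ** P i" for i k
  have W_self: "W i i \<preceq> (- c0) *\<^sub>R P i" if i: "i \<in> {1..K}" for i
    using loewner_le_jump[OF P_proj[OF i] c[OF i] absorb[OF i self_D[OF i]] _ c0_le[OF i]]
      VP[OF i i] absorb[OF i self_D[OF i]]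
    by (simp add: W_def)
  have W_other: "W i k \<preceq> 0" if i: "i \<in> {1..K}" and k: "k \<in> {1..K}" for i k
  proof (cases "k \<in> D i")
    case True
    \<comment> \<open>Condition (1) is stabilization with constant 0, so the same compression lemma
      applies.\<close>
    have "V k ** (U i)\<^sup>\<dagger> ** V k ** U i ** V k - V k \<preceq> (- 0) *\<^sub>R V k"
      using cond1[OF i True] by (simp add: loewner_le_def)
    from loewner_le_jump[OF P_proj[OF i] this absorb[OF i True] _ order_refl] show ?thesis
      using VP[OF i k] absorb[OF i True] by (simp add: W_def)
  next
    case False
    then have comm: "V k ** U i = U i ** V k"
      using D[OF i] k by (simp add: commutator_eq_0_iff)
    have "P i ** (U i)\<^sup>\<dagger> ** V k ** U i ** P i = P i ** (U i)\<^sup>\<dagger> ** (V k ** U i) ** P i"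
      by (simp add: matrix_mul_assoc)
    also have "\<dots> = P i ** V k ** P i"
      by (simp add: comm matrix_mul_assoc UUX[OF i])
    also have "\<dots> = V k ** P i"
      by (simp add: PP[OF i] flip: VP[OF i k] matrix_mul_assoc)
    finally show ?thesis
      by (simp add: W_def loewner_le_def)
  qed
  have jump: "(L i)\<^sup>\<dagger> ** V_tot ** L i - V_tot ** ((L i)\<^sup>\<dagger> ** L i) \<preceq> (- c0) *\<^sub>R P i"
    if i: "i \<in> {1..K}" for i
  proof -
    have "(L i)\<^sup>\<dagger> ** V_tot ** L i - V_tot ** ((L i)\<^sup>\<dagger> ** L i) = (\<Sum>k=1..K. W i k)"
      unfolding LL[OF i]
      by (simp add: L_eq[OF i] V_tot W_def dagger_mult Pd[OF i] matrix_mult_sum_left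
          matrix_mult_sum_right sum_subtractf matrix_mul_assoc)
    also have "\<dots> = W i i + (\<Sum>k\<in>{1..K} - {i}. W i k)"
      using i by (simp add: sum.remove)
    finally have eq: "(L i)\<^sup>\<dagger> ** V_tot ** L i - V_tot ** ((L i)\<^sup>\<dagger> ** L i) =
      W i i + (\<Sum>k\<in>{1..K} - {i}. W i k)" .
    have "positive_semidefinite (\<Sum>k\<in>{1..K} - {i}. - W i k)"
      using W_other[OF i] by (intro positive_semidefinite_sum) (simp add: loewner_le_def)
    from positive_semidefinite_add[OF W_self[OF i, unfolded loewner_le_def] this]
    show ?thesis
      unfolding eq loewner_le_def by (simp add: sum_negf algebra_simps)
  qed
  obtain \<mu> where \<mu>: "0 < \<mu>" and cover: "\<mu> *\<^sub>R V_tot \<preceq> (\<Sum>i=1..K. P i)"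
    using cond2 by (auto simp: P_def)
  have "hermitian (H i)" if "i \<in> {1..K}" for i
    unfolding H[OF that]
    by (intro hermitian_diff hermitian_scaleR V_herm that) (simp add: hermitian_def)
  then have H_herm: "hermitian H_tot"
    unfolding H_tot by (rule hermitian_sum)
  \<comment> \<open>\<open>H l\<close> is \<open>V l\<close> shifted by a multiple of the
    identity.\<close>
  have "V k ** H l = H l ** V k" if "k \<in> {1..K}" "l \<in> {1..K}" for k l
    using V_comm[OF that] H[OF that(2)]
    by (simp add: matrix_mult_diff_left matrix_mult_diff_right matrix_mult_scaleR_left
        matrix_mult_scaleR_right)
  then have VH: "V_tot ** H_tot = H_tot ** V_tot"
    unfolding V_tot H_tot matrix_mult_sum_left matrix_mult_sum_right
    by (subst sum.swap) (intro sum.cong refl)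
  show ?thesis
  proof (rule ground_state_stable_of_dissipation[OF mult_pos_pos[OF c0_pos \<mu>] _ H_herm VH])
    show "positive_semidefinite V_tot"
      unfolding V_tot
      by (intro positive_semidefinite_sum positive_semidefinite_projection V_projection)
    show "V_tot ** ((L j)\<^sup>\<dagger> ** L j) = (L j)\<^sup>\<dagger> ** L j ** V_tot" if "j \<in> {1..K}" for j
      unfolding LL[OF that] V_tot matrix_mult_sum_left matrix_mult_sum_right
      by (intro sum.cong refl VP that)
    let ?G = "\<lambda>j. (L j)\<^sup>\<dagger> ** V_tot ** L j - V_tot ** ((L j)\<^sup>\<dagger> ** L j)"
    have "positive_semidefinite (\<Sum>j=1..K. (- c0) *\<^sub>R P j - ?G j)"
      using jump unfolding loewner_le_def by (rule positive_semidefinite_sum)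
    moreover have "positive_semidefinite (c0 *\<^sub>R ((\<Sum>i=1..K. P i) - \<mu> *\<^sub>R V_tot))"
      using cover c0_pos by (intro positive_semidefinite_scaleR) (simp_all add: loewner_le_def)
    ultimately have "positive_semidefinite ((\<Sum>j=1..K. (- c0) *\<^sub>R P j - ?G j) +
        c0 *\<^sub>R ((\<Sum>i=1..K. P i) - \<mu> *\<^sub>R V_tot))"
      by (rule positive_semidefinite_add)
    \<comment> \<open>The sums of the \<open>P j\<close> cancel between the dissipation bound and
      \<open>c0\<close> times the covering bound, leaving the rate
      \<open>c0 * \<mu>\<close>.\<close>
    moreover have "(\<Sum>j=1..K. (- c0) *\<^sub>R P j - ?G j) + c0 *\<^sub>R ((\<Sum>i=1..K. P i) - \<mu> *\<^sub>R V_tot) =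
        (- (c0 * \<mu>)) *\<^sub>R V_tot - (\<Sum>j=1..K. ?G j)"
      by (simp add: sum_subtractf sum_negf scaleR_sum_right scaleR_diff_right)
    ultimately show "(\<Sum>j=1..K. ?G j) \<preceq> (- (c0 * \<mu>)) *\<^sub>R V_tot"
      by (simp only: loewner_le_def)
  qed
qed

end
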